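(* Let $R$ be a commutative ring with unity, let $U(R)$ be its set of units, and let $\Gamma'^{c}(R)$ be the complement unity product graph associated with $R$. If $|U(R)|\leq 2$, then $gr(\Gamma'^{c}(R))=\infty$.
   Context: For a ring $R$ with unity $e$ and set of units $U(R)$, the complement unity product graph $\Gamma'^{c}(R)$ is the simple graph with vertex set $U(R)$ in which two distinct vertices $r_i,r_j$ are adjacent if and only if $r_i\cdot r_j\neq e$. The girth $gr(\Gamma)$ of a graph $\Gamma$ is the length of a shortest cycle contained in $\Gamma$, with $gr(\Gamma)=\infty$ if $\Gamma$ contains no cycle. *)

theory Defs
  imports
    "HOL-Algebra.Ring"
    "HOL-Library.Extended_Nat"
    "Graph_Theory.Pair_Digraph"
begin

text \<open>
  Undirected simple graphs are rendered as symmetric loop-free sets of arcs, i.e. as the locale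
  \<^locale>\<open>pair_bidirected_digraph\<close>, which unlike \<^locale>\<open>pair_graph\<close> allows infinite graphs:
  each edge \<open>{u, v}\<close> is represented by the two arcs \<open>(u, v)\<close> and \<open>(v, u)\<close>.
\<close>

definition compl_unity_product_graph :: "('a, 'b) ring_scheme \<Rightarrow> 'a pair_pre_digraph" where
  "compl_unity_product_graph R =
    \<lparr> pverts = Units R,
      parcs = {(u, v). u \<in> Units R \<and> v \<in> Units R \<and> u \<noteq> v \<and> u \<otimes>\<^bsub>R\<^esub> v \<noteq> \<one>\<^bsub>R\<^esub>} \<rparr>"

lemma pair_bidirected_digraph_compl_unity_product_graph:
  assumes "ring R"
  shows "pair_bidirected_digraph (compl_unity_product_graph R)"
proof -
  interpret ring R by fact
  have "v \<otimes>\<^bsub>R\<^esub> u \<noteq> \<one>\<^bsub>R\<^esub>"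
    if "u \<in> Units R" "v \<in> Units R" "u \<otimes>\<^bsub>R\<^esub> v \<noteq> \<one>\<^bsub>R\<^esub>" for u v
    using that by (metis Units_closed Units_inv_comm)
  then show ?thesis
    by unfold_locales
      (auto simp: compl_unity_product_graph_def symmetric_def intro!: symI)
qed

text \<open>
  For a directed graph, \<^const>\<open>pre_digraph.cycle\<close> only asks for a nonempty closed walk without
  repeated vertices, so traversing a single edge back and forth, \<open>u, v, u\<close>, counts. The bound on
  the length excludes exactly these walks; the rest are the cycles of the undirected graph.
\<close>

definition undirected_cycle :: "'a pair_pre_digraph \<Rightarrow> ('a \<times> 'a) awalk \<Rightarrow> bool" where
  "undirected_cycle G p \<longleftrightarrow> pre_digraph.cycle (with_proj G) p \<and> 3 \<le> length p"

text \<open>The infimum of the empty set of type \<^typ>\<open>enat\<close> is \<open>\<infinity>\<close>.\<close>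

definition girth :: "'a pair_pre_digraph \<Rightarrow> enat" where
  "girth G = (INF p \<in> {p. undirected_cycle G p}. enat (length p))"

end

theory Submission
  imports Defs
begin

text \<open>
  A cycle visits as many distinct vertices as it has edges
  (\<open>wf_digraph.length_cycle_le_card_verts\<close>), and a cycle of a simple graph has at least three
  edges. A graph on at most two vertices therefore has no cycle, and its girth is an infimum over
  the empty set (\<open>girth_eq_infinity_if_card_verts_le_2\<close>). The
  complement unity product graph is such a graph, since its vertices are the units.
\<close>

text \<open>
  The start vertex of a cycle occurs again at its end, so dropping its first occurrence leaves one
  vertex for each arc; these vertices are distinct.
\<close>

lemma (in wf_digraph) length_cycle_le_card_verts:
  assumes "finite (verts G)" and "cycle p"
  shows "length p \<le> card (verts G)"
proof -
  obtain u where walk: "awalk u p u" and dist: "distinct (tl (awalk_verts u p))"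
    using \<open>cycle p\<close> unfolding cycle_def by blast
  have "set (tl (awalk_verts u p)) \<subseteq> verts G"
    using walk by (meson awalkE' list.set_sel(2) subset_iff awalk_verts_non_Nil)
  then have "card (set (tl (awalk_verts u p))) \<le> card (verts G)"
    using \<open>finite (verts G)\<close> by (rule card_mono[rotated])
  then show ?thesis
    using dist by (simp add: distinct_card length_awalk_verts)
qed

lemma girth_eq_infinity_if_card_verts_le_2:
  assumes "pair_wf_digraph G" and "finite (pverts G)" and "card (pverts G) \<le> 2"
  shows "girth G = \<infinity>"
proof -
  interpret pair_wf_digraph G by fact
  have "\<not> undirected_cycle G p" for p
    using length_cycle_le_card_verts[of p] assms(2,3)
    by (auto simp: undirected_cycle_def)
  then show ?thesis
    by (simp add: girth_def top_enat_def)
qed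

theorem theorem4p2:
  fixes R :: "('a, 'b) ring_scheme"
  assumes "cring R"
    and "finite (Units R)" and "card (Units R) \<le> 2"
  shows "girth (compl_unity_product_graph R) = \<infinity>"
proof (rule girth_eq_infinity_if_card_verts_le_2)
  interpret cring R by fact
  interpret G: pair_bidirected_digraph "compl_unity_product_graph R"
    by (intro pair_bidirected_digraph_compl_unity_product_graph ring_axioms)
  show "pair_wf_digraph (compl_unity_product_graph R)"
    by unfold_locales
qed (use assms(2,3) in \<open>simp_all add: compl_unity_product_graph_def\<close>)

end
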